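(* Let $N\ge2$ and let $k$ be a positive integer with $k<N$. Let $\{\Omega_p\}_{p\in(0,1)}$ be a family of bounded convex domains of $\mathbb{R}^N$ such that, for each $p$, $\Omega_p=\bigcap_{y\in Y(p)}B_{R(p)}(y)$ for some $R(p)>0$ and some $Y(p)\subseteq\mathbb{R}^N$. For each $p\in(0,1)$ let $U_p\in C(\overline{\Omega_p})$ be the unique solution of $$U_p>0,\quad \mathcal{P}^-_k(D^2U_p)+U_p^p=0\ \text{ in }\Omega_p,\qquad U_p=0\ \text{ on }\partial\Omega_p ,$$ let $M_p=\max_{\overline{\Omega_p}}U_p$, and set $$\tilde U_p(x)=\frac{1}{M_p}\,U_p\!\left(M_p^{\frac{1-p}{2}}x\right),\qquad x\in M_p^{\frac{p-1}{2}}\,\Omega_p .$$ Assume that there exist $\bar x_p,\hat x_p\in\mathbb{R}^N$ and $\bar\rho_p,\hat\rho_p>0$ such that $$B_{\sqrt{\frac{2k}{1-p}}-\bar\rho_p}(\bar x_p)\subseteq\Omega_p\subseteq B_{\sqrt{\frac{2k}{1-p}}+\hat\rho_p}(\hat x_p).$$ If $$|\bar x_p|+|\hat x_p|\to0\quad\text{and}\quad\frac{\bar\rho_p+\hat\rho_p}{\sqrt{1-p}}\to0\qquad\text{as }p\to1,$$ then $\displaystyle\lim_{p\to1}\tilde U_p(x)=\exp\left(-\frac{|x|^2}{2k}\right)$ locally uniformly in $\mathbb{R}^N$.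
   Context: For a real symmetric $N\times N$ matrix $X$ with eigenvalues $\lambda_1(X)\le\dots\le\lambda_N(X)$, $\mathcal{P}^-_k(X)=\sum_{i=1}^k\lambda_i(X)$. $B_r(y)$ denotes the open ball of radius $r$ centered at $y$. The limit $p\to1$ is from below. Solutions are understood in the viscosity sense: a nonnegative continuous $u$ solves $\mathcal{P}^-_k(D^2u)+u^p=0$ in $\Omega$ if, for every $\varphi\in C^2(\Omega)$ and $x_0\in\Omega$, $\mathcal{P}^-_k(D^2\varphi(x_0))+u(x_0)^p\ge0$ whenever $u-\varphi$ has a local maximum at $x_0$, and $\le0$ whenever $u-\varphi$ has a local minimum at $x_0$. It is known that for $p\in(0,1)$, $k<N$ and a bounded domain $\Omega\subset\mathbb{R}^N$ that is an intersection of open balls of a common radius, the Dirichlet problem $u>0$, $\mathcal{P}^-_k(D^2u)+u^p=0$ in $\Omega$, $u=0$ on $\partial\Omega$, has a unique solution, continuous up to the boundary. Locally uniform convergence in $\mathbb{R}^N$ means: for every compact $K\subset\mathbb{R}^N$, $K$ is contained in the domain of $\tilde U_p$ for $p$ close enough to $1$, and the convergence is uniform on $K$. *)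

theory Defs
  imports "HOL-Analysis.Analysis" "HOL-Computational_Algebra.Polynomial"
begin

definition charpoly :: "real^'n^'n \<Rightarrow> real poly" where
  "charpoly A = det (mat [:0, 1:] - map_matrix (\<lambda>a. [:a:]) A)"

text \<open>The real eigenvalues in increasing order, repeated according to algebraic multiplicity.
  For a symmetric matrix this list has length \<open>CARD('n)\<close>; the eigenvalue usually written
  \<open>\<lambda>\<^sub>i\<close> is at position \<open>i - 1\<close>.\<close>

definition eigenvalues :: "real^'n^'n \<Rightarrow> real list" where
  "eigenvalues A = sorted_list_of_multiset (proots (charpoly A))"

definition P_minus :: "nat \<Rightarrow> real^'n^'n \<Rightarrow> real" where
  "P_minus k A = (\<Sum>i = 1..k. eigenvalues A ! (i - 1))"

text \<open>\<open>\<phi>\<close> is of class \<open>C\<^sup>2\<close> on the open set \<open>\<Omega>\<close>, with gradient \<open>G\<close> and Hessian \<open>H\<close>.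
  On \<open>\<Omega>\<close> both \<open>G\<close> and \<open>H\<close> are determined by \<open>\<phi>\<close>.\<close>

definition C2_on :: "(real^'n) set \<Rightarrow> (real^'n \<Rightarrow> real) \<Rightarrow> (real^'n \<Rightarrow> real^'n) \<Rightarrow>
    (real^'n \<Rightarrow> real^'n^'n) \<Rightarrow> bool" where
  "C2_on \<Omega> \<phi> G H \<longleftrightarrow>
     (\<forall>x\<in>\<Omega>. (\<phi> has_derivative (\<lambda>h. G x \<bullet> h)) (at x)) \<and>
     (\<forall>x\<in>\<Omega>. (G has_derivative (\<lambda>h. H x *v h)) (at x)) \<and>
     continuous_on \<Omega> H"

definition local_max_at :: "(real^'n) set \<Rightarrow> (real^'n \<Rightarrow> real) \<Rightarrow> real^'n \<Rightarrow> bool" where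
  "local_max_at \<Omega> f x0 \<longleftrightarrow> (\<forall>\<^sub>F x in at x0 within \<Omega>. f x \<le> f x0)"

definition local_min_at :: "(real^'n) set \<Rightarrow> (real^'n \<Rightarrow> real) \<Rightarrow> real^'n \<Rightarrow> bool" where
  "local_min_at \<Omega> f x0 \<longleftrightarrow> (\<forall>\<^sub>F x in at x0 within \<Omega>. f x0 \<le> f x)"

text \<open>Nonnegative viscosity solutions of \<open>P_minus k (D\<^sup>2 u) + u\<^sup>p = 0\<close> in the open set \<open>\<Omega>\<close>.\<close>

definition viscosity_solution ::
    "nat \<Rightarrow> real \<Rightarrow> (real^'n) set \<Rightarrow> (real^'n \<Rightarrow> real) \<Rightarrow> bool" where
  "viscosity_solution k p \<Omega> u \<longleftrightarrow>
     continuous_on \<Omega> u \<and> (\<forall>x\<in>\<Omega>. 0 \<le> u x) \<and>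
     (\<forall>\<phi> G H x0. C2_on \<Omega> \<phi> G H \<longrightarrow> x0 \<in> \<Omega> \<longrightarrow>
        (local_max_at \<Omega> (\<lambda>x. u x - \<phi> x) x0 \<longrightarrow> P_minus k (H x0) + u x0 powr p \<ge> 0) \<and>
        (local_min_at \<Omega> (\<lambda>x. u x - \<phi> x) x0 \<longrightarrow> P_minus k (H x0) + u x0 powr p \<le> 0))"

definition dirichlet_solution ::
    "nat \<Rightarrow> real \<Rightarrow> (real^'n) set \<Rightarrow> (real^'n \<Rightarrow> real) \<Rightarrow> bool" where
  "dirichlet_solution k p \<Omega> u \<longleftrightarrow>
     continuous_on (closure \<Omega>) u \<and> (\<forall>x\<in>\<Omega>. 0 < u x) \<and>
     viscosity_solution k p \<Omega> u \<and> (\<forall>x\<in>frontier \<Omega>. u x = 0)"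

text \<open>For \<open>u\<close> continuous on the compact nonempty set \<open>closure \<Omega>\<close> the supremum is attained,
  i.e. it is the maximum.\<close>

definition max_value :: "(real^'n) set \<Rightarrow> (real^'n \<Rightarrow> real) \<Rightarrow> real" where
  "max_value \<Omega> u = (SUP x\<in>closure \<Omega>. u x)"

definition rescaled :: "real \<Rightarrow> (real^'n) set \<Rightarrow> (real^'n \<Rightarrow> real) \<Rightarrow> real^'n \<Rightarrow> real" where
  "rescaled p \<Omega> u x = u ((max_value \<Omega> u powr ((1 - p) / 2)) *\<^sub>R x) / max_value \<Omega> u"

definition rescaled_domain ::
    "real \<Rightarrow> (real^'n) set \<Rightarrow> (real^'n \<Rightarrow> real) \<Rightarrow> (real^'n) set" where
  "rescaled_domain p \<Omega> u = (\<lambda>x. (max_value \<Omega> u powr ((p - 1) / 2)) *\<^sub>R x) ` \<Omega>"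

end

theory Submission
  imports Defs
begin

text \<open>On the ball of radius \<open>r\<close> about \<open>z\<close> the equation is solved by
  \<open>((1 - p) / (2 k) * (r\<^sup>2 - |x - z|\<^sup>2)) powr (1 / (1 - p))\<close>: its Hessian is a negative
  multiple of the identity plus a nonnegative rank-one matrix, so for \<open>k < N\<close> only the multiple of
  the identity enters \<open>P_minus k\<close>. Because \<open>s \<mapsto> s\<^sup>p\<close> is strictly sublinear, looking at the extremum of
  the quotient of a solution and such a barrier gives comparison with inscribed and circumscribed
  balls. For \<open>r\<^sup>2 = 2 k / (1 - p)\<close> the centred barrier is
  \<open>(1 - (1 - p) |x|\<^sup>2 / (2 k)) powr (1 / (1 - p))\<close>, which tends to the Gaussian, and radius
  errors that are \<open>o(sqrt (1 - p))\<close> change it only by a factor tending to 1.\<close>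

section \<open>Spectrum of a multiple of the identity plus a rank-one matrix\<close>

definition scalar_plus_rank_one :: "real \<Rightarrow> real \<Rightarrow> real^'n \<Rightarrow> real^'n^'n" where
  "scalar_plus_rank_one \<alpha> \<beta> w = (\<chi> i j. (if i = j then \<alpha> else 0) + \<beta> * w $ i * w $ j)"

lemma scalar_plus_rank_one_mult_vec:
  "scalar_plus_rank_one \<alpha> \<beta> w *v h = \<alpha> *\<^sub>R h + (\<beta> * (w \<bullet> h)) *\<^sub>R w"
proof -
  have "((if i = j then \<alpha> else 0) + \<beta> * w $ i * w $ j) * h $ j =
      (if i = j then \<alpha> * h $ j else 0) + \<beta> * w $ i * (w $ j * h $ j)" for i j
    by (simp add: algebra_simps)
  then show ?thesis
    by (simp add: vec_eq_iff scalar_plus_rank_one_def matrix_vector_mult_def inner_vec_def sum.distrib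
        sum_distrib_left[symmetric])
qed

text \<open>An orthogonal change of basis takes a coordinate axis to the direction of
  \<open>w\<close>; in that basis the matrix is diagonal and at most one entry differs from
  \<open>\<alpha>\<close>.\<close>

lemma det_scalar_plus_rank_one:
  fixes w :: "real^'n"
  shows "det (scalar_plus_rank_one \<alpha> \<beta> w) = \<alpha> ^ (CARD('n) - 1) * (\<alpha> + \<beta> * (norm w)\<^sup>2)"
proof -
  fix k :: 'n
  define D :: "real^'n^'n" where
    "D = (\<chi> i j. if i = j then \<alpha> + (if i = k then \<beta> * (norm w)\<^sup>2 else 0) else 0)"
  \<comment> \<open>Keeping the factor \<open>norm w\<close> on the left covers \<open>w = 0\<close>
    in the same formula; there any orthogonal matrix serves.\<close>
  obtain A :: "real^'n^'n" where A: "orthogonal_matrix A" "norm w *\<^sub>R (A *v axis k 1) = w"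
  proof (cases "w = 0")
    case True
    show ?thesis by (rule that[OF orthogonal_matrix_id]) (simp add: True)
  next
    case False
    then have "norm (w /\<^sub>R norm w) = 1" by simp
    then obtain A where A: "orthogonal_matrix A" "A *v axis k 1 = w /\<^sub>R norm w"
      by (rule orthogonal_matrix_exists_basis)
    show ?thesis by (rule that[OF A(1)]) (use False in \<open>simp add: A(2)\<close>)
  qed
  have w: "w $ i = norm w * A $ i $ k" for i
  proof -
    have "w $ i = (norm w *\<^sub>R (A *v axis k 1)) $ i" by (simp only: A(2))
    then show ?thesis by (simp add: matrix_vector_mult_basis column_def)
  qed
  have AAT: "(\<Sum>l\<in>UNIV. A $ i $ l * A $ j $ l) = (if i = j then 1 else 0)" for i j
  proof -
    have "(A ** transpose A) $ i $ j = mat 1 $ i $ j"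
      using A(1) by (simp add: orthogonal_matrix_def)
    then show ?thesis by (simp add: matrix_matrix_mult_def transpose_def mat_def)
  qed
  have "(A ** D ** transpose A) $ i $ j = scalar_plus_rank_one \<alpha> \<beta> w $ i $ j" for i j
  proof -
    have "(A ** D ** transpose A) $ i $ j =
        (\<Sum>l\<in>UNIV. A $ i $ l * (\<alpha> + (if l = k then \<beta> * (norm w)\<^sup>2 else 0)) * A $ j $ l)"
      by (simp add: matrix_matrix_mult_def transpose_def D_def mult_delta_right)
    also have "\<dots> = \<alpha> * (\<Sum>l\<in>UNIV. A $ i $ l * A $ j $ l) +
        \<beta> * (norm w)\<^sup>2 * A $ i $ k * A $ j $ k"
    proof -
      have "A $ i $ l * (\<alpha> + (if l = k then \<beta> * (norm w)\<^sup>2 else 0)) * A $ j $ l =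
        \<alpha> * (A $ i $ l * A $ j $ l) +
        (if l = k then \<beta> * (norm w)\<^sup>2 * A $ i $ k * A $ j $ k else 0)" for l
        by (simp add: algebra_simps)
      then show ?thesis by (simp add: sum.distrib sum_distrib_left)
    qed
    also have "\<dots> = scalar_plus_rank_one \<alpha> \<beta> w $ i $ j"
      by (simp add: AAT scalar_plus_rank_one_def w[of i] w[of j] power2_eq_square)
    finally show ?thesis .
  qed
  then have "scalar_plus_rank_one \<alpha> \<beta> w = A ** D ** transpose A"
    by (simp add: vec_eq_iff)
  moreover have "det A * det A = 1"
    using det_orthogonal_matrix[OF A(1)] by (elim disjE) simp_all
  moreover have "det D = \<alpha> ^ (CARD('n) - 1) * (\<alpha> + \<beta> * (norm w)\<^sup>2)"
  proof -
    have "det D = (\<Prod>i\<in>UNIV. \<alpha> + (if i = k then \<beta> * (norm w)\<^sup>2 else 0))"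
      by (subst det_diagonal) (auto simp: D_def)
    also have "\<dots> = (\<alpha> + \<beta> * (norm w)\<^sup>2) * (\<Prod>i\<in>UNIV - {k}. \<alpha>)"
      by (subst prod.remove[of _ k]) auto
    finally show ?thesis by (simp add: card_Diff_singleton mult.commute)
  qed
  moreover have "det (A ** D ** transpose A) = (det A * det A) * det D"
    by (simp add: det_mul)
  ultimately show ?thesis by simp
qed

lemma poly_charpoly: "poly (charpoly A) x = det (mat x - A)"
proof -
  have "poly (if i = j then [:0, 1:] else 0) x = (if i = j then x else 0)" for i j :: 'a
    by simp
  then show ?thesis
    by (simp add: charpoly_def det_def poly_sum poly_prod mat_def map_matrix_def sign_def
        if_distrib[of "\<lambda>q. poly q x"] cong: if_cong)
qed

text \<open>Subtracting the matrix from \<open>mat x\<close> gives a matrix of the same shape, so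
  the determinant formula evaluates the polynomial at every point; real polynomials that agree
  everywhere are equal.\<close>

lemma charpoly_scalar_plus_rank_one:
  fixes w :: "real^'n"
  shows "charpoly (scalar_plus_rank_one \<alpha> \<beta> w) =
    [:-\<alpha>, 1:] ^ (CARD('n) - 1) * [:-(\<alpha> + \<beta> * (norm w)\<^sup>2), 1:]"
proof -
  have "mat x - scalar_plus_rank_one \<alpha> \<beta> w = scalar_plus_rank_one (x - \<alpha>) (-\<beta>) w" for x
    by (auto simp: vec_eq_iff mat_def scalar_plus_rank_one_def)
  then have "poly (charpoly (scalar_plus_rank_one \<alpha> \<beta> w)) x =
      poly ([:-\<alpha>, 1:] ^ (CARD('n) - 1) * [:-(\<alpha> + \<beta> * (norm w)\<^sup>2), 1:]) x" for x
    by (simp add: poly_charpoly det_scalar_plus_rank_one algebra_simps)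
  then show ?thesis by (intro poly_eq_poly_eq_iff[THEN iffD1] ext)
qed

text \<open>\<open>0 \<le> \<beta>\<close> puts the exceptional eigenvalue at the end of the sorted
  list, and \<open>k < CARD('n)\<close> stops the sum before it.\<close>

lemma P_minus_scalar_plus_rank_one:
  fixes w :: "real^'n"
  assumes "0 \<le> \<beta>" and "k < CARD('n)"
  shows "P_minus k (scalar_plus_rank_one \<alpha> \<beta> w) = real k * \<alpha>"
proof -
  let ?xs = "replicate (CARD('n) - 1) \<alpha> @ [\<alpha> + \<beta> * (norm w)\<^sup>2]"
  have "proots (charpoly (scalar_plus_rank_one \<alpha> \<beta> w)) = mset ?xs"
    unfolding charpoly_scalar_plus_rank_one
    by (subst proots_mult) (auto simp: proots_power)
  moreover have "sorted ?xs"
    using assms(1) by (auto simp: sorted_append)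
  ultimately have "eigenvalues (scalar_plus_rank_one \<alpha> \<beta> w) = ?xs"
    unfolding eigenvalues_def by (metis sorted_list_of_multiset_mset sorted_sort_id)
  moreover have "?xs ! (i - 1) = \<alpha>" if "i \<in> {1..k}" for i
    using that assms(2) by (auto simp: nth_append)
  ultimately show ?thesis by (simp add: P_minus_def)
qed

section \<open>Radial barriers and their second derivatives\<close>

lemma has_real_derivative_max_0_powr:
  fixes a s :: real
  assumes "1 < a"
  shows "((\<lambda>s. max 0 s powr a) has_real_derivative a * max 0 s powr (a - 1)) (at s)"
proof (cases s "0::real" rule: linorder_cases)
  case less
  have "((\<lambda>s. 0) has_real_derivative 0) (at s)" by simp
  then have "((\<lambda>s. max 0 s powr a) has_real_derivative 0) (at s)"
    by (rule DERIV_cong_ev[THEN iffD1, OF refl _ refl, rotated])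
      (use less in \<open>auto intro!: eventually_mono[OF eventually_nhds_in_open[of "{..<0}"]]\<close>)
  then show ?thesis using less by simp
next
  case greater
  have "((\<lambda>s. s powr a) has_real_derivative a * s powr (a - 1)) (at s)"
    using greater by (auto intro!: derivative_eq_intros)
  then have "((\<lambda>s. max 0 s powr a) has_real_derivative a * s powr (a - 1)) (at s)"
    by (rule DERIV_cong_ev[THEN iffD1, OF refl _ refl, rotated])
      (use greater in \<open>auto intro!: eventually_mono[OF eventually_nhds_in_open[of "{0<..}"]]\<close>)
  then show ?thesis using greater by simp
next
  case equal
  \<comment> \<open>At the kink this power dominates the difference quotient, and it tends to 0
    because \<open>1 < a\<close>.\<close>
  have "((\<lambda>h::real. \<bar>h\<bar> powr (a - 1)) \<longlongrightarrow> 0) (at 0)"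
    using assms by (auto intro!: tendsto_eq_intros)
  moreover have "\<forall>\<^sub>F h in at 0. norm ((max 0 (0 + h) powr a - max 0 0 powr a) / h) \<le> \<bar>h\<bar> powr (a - 1)"
  proof (rule eventually_mono[OF eventually_at_filter[THEN iffD2, OF always_eventually]], rule)
    fix h :: real
    show "norm ((max 0 (0 + h) powr a - max 0 0 powr a) / h) \<le> \<bar>h\<bar> powr (a - 1)"
      by (cases h "0::real" rule: linorder_cases) (auto simp: powr_diff divide_nonneg_neg)
  qed auto
  ultimately have "((\<lambda>h. (max 0 (0 + h) powr a - max 0 0 powr a) / h) \<longlongrightarrow> 0) (at (0::real))"
    by (rule Lim_null_comparison[rotated])
  then show ?thesis using equal assms by (simp add: DERIV_def)
qed

text \<open>Truncated at \<open>0\<close>, so that for \<open>q > 2\<close> it is \<open>C\<^sup>2\<close> on the whole space and hence admissible as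
  a test function on domains larger than the ball.\<close>

definition barrier :: "real \<Rightarrow> real \<Rightarrow> real \<Rightarrow> real^'n \<Rightarrow> real^'n \<Rightarrow> real" where
  "barrier c q r z x = max 0 (c * (r\<^sup>2 - (norm (x - z))\<^sup>2)) powr q"

text \<open>The chain rule is applied twice to powers of the truncated quadratic.
  \<open>2 < q\<close> leaves the positive exponent \<open>q - 2\<close> in the Hessian, which
  therefore stays continuous across the sphere. The factor \<open>t\<close> is carried along because
  the comparison arguments test with multiples of a barrier.\<close>

lemma C2_on_barrier:
  fixes c q r t :: real and z :: "real^'n"
  assumes "2 < q"
  defines "m \<equiv> \<lambda>x. max 0 (c * (r\<^sup>2 - (norm (x - z))\<^sup>2))"
  defines "\<alpha> \<equiv> \<lambda>x. - 2 * c * q * t * m x powr (q - 1)"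
    and "\<beta> \<equiv> \<lambda>x. 4 * c\<^sup>2 * q * (q - 1) * t * m x powr (q - 2)"
  shows "C2_on S (\<lambda>x. t * barrier c q r z x) (\<lambda>x. \<alpha> x *\<^sub>R (x - z))
    (\<lambda>x. scalar_plus_rank_one (\<alpha> x) (\<beta> x) (x - z))"
proof -
  have s: "((\<lambda>x. c * (r\<^sup>2 - (norm (x - z))\<^sup>2)) has_derivative (\<lambda>h. - 2 * c * ((x - z) \<bullet> h))) (at x)" for x
    unfolding power2_norm_eq_inner
    by (auto intro!: derivative_eq_intros simp: inner_commute algebra_simps)
  have pw: "((\<lambda>x. m x powr a) has_derivative (\<lambda>h. a * m x powr (a - 1) * (- 2 * c * ((x - z) \<bullet> h)))) (at x)"
    if "1 < a" for a x
    using has_derivative_compose[OF s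
        has_real_derivative_max_0_powr[OF that, unfolded has_field_derivative_def], of x]
    by (simp add: m_def)
  have "((\<lambda>x. t * barrier c q r z x) has_derivative (\<lambda>h. (\<alpha> x *\<^sub>R (x - z)) \<bullet> h)) (at x)" for x
    using has_derivative_mult_right[OF pw[of q x], of t] assms(1)
    by (simp add: barrier_def m_def \<alpha>_def mult_ac)
  moreover have "((\<lambda>x. \<alpha> x *\<^sub>R (x - z)) has_derivative
      (\<lambda>h. scalar_plus_rank_one (\<alpha> x) (\<beta> x) (x - z) *v h)) (at x)" for x
  proof -
    have "(\<alpha> has_derivative (\<lambda>h. \<beta> x * ((x - z) \<bullet> h))) (at x)"
      unfolding \<alpha>_def
      by (rule has_derivative_eq_rhs[OF has_derivative_mult_right[OF pw]])
        (use assms(1) in \<open>auto simp: \<beta>_def algebra_simps power2_eq_square\<close>)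
    then show ?thesis
      by (auto intro!: derivative_eq_intros simp: scalar_plus_rank_one_mult_vec)
  qed
  moreover have "continuous_on S (\<lambda>x. scalar_plus_rank_one (\<alpha> x) (\<beta> x) (x - z))"
  proof -
    have "continuous_on S (\<lambda>x. if i = j then \<alpha> x else 0)" for i j :: 'n
      using assms(1) by (cases "i = j")
        (auto simp: \<alpha>_def m_def intro!: continuous_intros continuous_on_powr')
    moreover have "continuous_on S \<beta>"
      using assms(1) by (auto simp: \<beta>_def m_def intro!: continuous_intros continuous_on_powr')
    ultimately show ?thesis
      unfolding scalar_plus_rank_one_def by (intro continuous_intros)
  qed
  ultimately show ?thesis by (simp add: C2_on_def)
qed

lemma continuous_on_barrier [continuous_intros]:
  "0 < q \<Longrightarrow> continuous_on S (barrier c q r z)"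
  unfolding barrier_def [abs_def]
  by (auto intro!: continuous_intros continuous_on_powr')

lemma barrier_pos:
  assumes "0 < c" and "dist z x < r"
  shows "0 < barrier c q r z x"
proof -
  have "(norm (x - z))\<^sup>2 < r\<^sup>2"
    using assms(2) by (intro power_strict_mono) (auto simp: dist_norm norm_minus_commute)
  with assms(1) show ?thesis by (simp add: barrier_def)
qed

lemma barrier_eq_0:
  assumes "0 \<le> c" and "0 \<le> r" and "r \<le> dist z x"
  shows "barrier c q r z x = 0"
proof -
  have "r\<^sup>2 \<le> (norm (x - z))\<^sup>2"
    using assms(2,3) by (intro power_mono) (auto simp: dist_norm norm_minus_commute)
  with assms(1) show ?thesis by (simp add: barrier_def max_absorb1 mult_nonneg_nonpos)
qed

section \<open>Comparison of solutions with barriers on balls\<close>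

lemma viscosity_solution_touching_barrier:
  fixes z :: "real^'n" and r :: real
  assumes u: "viscosity_solution k p \<Omega> u" and k: "0 < k" "k < CARD('n)" and p: "1/2 < p" "p < 1"
    and t: "0 \<le> t" and x0: "x0 \<in> \<Omega>"
  defines "v \<equiv> barrier ((1 - p) / (2 * k)) (1 / (1 - p)) r z"
  shows "local_max_at \<Omega> (\<lambda>x. u x - t * v x) x0 \<Longrightarrow> t * v x0 powr p \<le> u x0 powr p"
    and "local_min_at \<Omega> (\<lambda>x. u x - t * v x) x0 \<Longrightarrow> u x0 powr p \<le> t * v x0 powr p"
proof -
  define c q where "c = (1 - p) / (2 * k)" and "q = 1 / (1 - p)"
  \<comment> \<open>\<open>q * p = q - 1\<close> matches the power in the Hessian with
    \<open>v powr p\<close>, \<open>2 * k * c * q = 1\<close> normalises its coefficient, and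
    \<open>2 < q\<close> is where \<open>1/2 < p\<close> enters.\<close>
  have cq: "2 * k * c * q = 1" and q: "2 < q" and qp: "q * p = q - 1"
    using k p by (auto simp: c_def q_def field_simps)
  define m where "m = (\<lambda>x. max 0 (c * (r\<^sup>2 - (norm (x - z))\<^sup>2)))"
  define \<alpha> \<beta> where "\<alpha> = (\<lambda>x. - 2 * c * q * t * m x powr (q - 1))"
    and "\<beta> = (\<lambda>x. 4 * c\<^sup>2 * q * (q - 1) * t * m x powr (q - 2))"
  have C2: "C2_on \<Omega> (\<lambda>x. t * v x) (\<lambda>x. \<alpha> x *\<^sub>R (x - z))
      (\<lambda>x. scalar_plus_rank_one (\<alpha> x) (\<beta> x) (x - z))"
    using C2_on_barrier[OF q, of \<Omega> t c r z]
    unfolding v_def c_def[symmetric] q_def[symmetric] \<alpha>_def \<beta>_def m_def .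
  \<comment> \<open>The Hessian is linear in \<open>t\<close>, so the result is
    \<open>t * v x0 powr p\<close> up to sign, and not \<open>(t * v x0) powr p\<close>; this
    mismatch drives both comparisons.\<close>
  have "P_minus k (scalar_plus_rank_one (\<alpha> x0) (\<beta> x0) (x0 - z)) = k * \<alpha> x0"
    using q t k by (intro P_minus_scalar_plus_rank_one) (auto simp: \<beta>_def)
  also have "\<dots> = - (2 * k * c * q) * (t * m x0 powr (q - 1))"
    by (simp add: \<alpha>_def)
  also have "\<dots> = - t * v x0 powr p"
    unfolding cq v_def c_def[symmetric] q_def[symmetric] barrier_def powr_powr qp m_def by simp
  finally have P: "P_minus k (scalar_plus_rank_one (\<alpha> x0) (\<beta> x0) (x0 - z)) = - t * v x0 powr p" .
  note u[unfolded viscosity_solution_def, THEN conjunct2, THEN conjunct2, THEN spec, THEN spec,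
      THEN spec, THEN spec, THEN mp, OF C2, THEN mp, OF x0, unfolded P]
  then show "local_max_at \<Omega> (\<lambda>x. u x - t * v x) x0 \<Longrightarrow> t * v x0 powr p \<le> u x0 powr p"
    and "local_min_at \<Omega> (\<lambda>x. u x - t * v x) x0 \<Longrightarrow> u x0 powr p \<le> t * v x0 powr p"
    by auto
qed

text \<open>If \<open>u\<close> exceeded \<open>v\<close> somewhere, the largest quotient
  \<open>t\<close> of \<open>u\<close> by \<open>v\<close> would be greater than 1 and
  \<open>t * v\<close> would touch \<open>u\<close> from above. The equation then yields
  \<open>t \<le> t powr p\<close>, impossible for \<open>p < 1\<close>. Having the closure inside
  the open ball keeps \<open>v\<close> positive up to the frontier, so the quotient is
  continuous.\<close>

lemma dirichlet_solution_le_barrier: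
  fixes z :: "real^'n"
  assumes u: "dirichlet_solution k p \<Omega> u" and \<Omega>: "bounded \<Omega>" "closure \<Omega> \<subseteq> ball z r"
    and k: "0 < k" "k < CARD('n)" and p: "1/2 < p" "p < 1" and y: "y \<in> closure \<Omega>"
  shows "u y \<le> barrier ((1 - p) / (2 * k)) (1 / (1 - p)) r z y"
proof (rule ccontr)
  define v where "v = barrier ((1 - p) / (2 * k)) (1 / (1 - p)) r z"
  assume "\<not> ?thesis"
  then have less: "v y < u y" by (simp add: v_def)
  have v_pos: "0 < v x" if "x \<in> closure \<Omega>" for x
    using that \<Omega>(2) k p by (auto simp: v_def intro!: barrier_pos)
  have cont: "continuous_on (closure \<Omega>) (\<lambda>x. u x / v x)"
  proof (intro continuous_intros ballI)
    show "continuous_on (closure \<Omega>) u"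
      using u by (simp add: dirichlet_solution_def)
    show "continuous_on (closure \<Omega>) v"
      using p unfolding v_def by (intro continuous_intros) auto
  qed (use v_pos in force)
  obtain x0 where x0: "x0 \<in> closure \<Omega>" and max: "\<And>x. x \<in> closure \<Omega> \<Longrightarrow> u x / v x \<le> u x0 / v x0"
    using continuous_attains_sup[OF _ _ cont] y \<Omega>(1) compact_closure by (metis empty_iff)
  define t where "t = u x0 / v x0"
  have t: "1 < t"
    using less_le_trans[OF _ max[OF y], of 1] less v_pos[OF y] by (simp add: t_def)
  have u_x0: "u x0 = t * v x0" using v_pos[OF x0] by (simp add: t_def)
  \<comment> \<open>Since \<open>u\<close> vanishes on the frontier, this places the maximum point
    in \<open>\<Omega>\<close>, where the viscosity condition applies.\<close>
  have "u x0 \<noteq> 0" using u_x0 t v_pos[OF x0] by simp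
  then have "x0 \<in> \<Omega>"
    using x0 u closure_Un_frontier[of \<Omega>] by (auto simp: dirichlet_solution_def)
  moreover have "local_max_at \<Omega> (\<lambda>x. u x - t * v x) x0"
    unfolding local_max_at_def eventually_at_filter
  proof (intro always_eventually allI impI)
    fix x assume "x \<in> \<Omega>"
    then have "x \<in> closure \<Omega>" using closure_subset by blast
    from max[OF this] v_pos[OF this] show "u x - t * v x \<le> u x0 - t * v x0"
      unfolding t_def[symmetric] by (simp add: u_x0 divide_le_eq)
  qed
  ultimately have "t * v x0 powr p \<le> u x0 powr p"
    using viscosity_solution_touching_barrier(1)[of k p \<Omega> u t x0 r z] u k p t
    by (simp add: dirichlet_solution_def v_def)
  also have "\<dots> = t powr p * v x0 powr p"
    using u_x0 t v_pos[OF x0] by (simp add: powr_mult)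
  finally have "t \<le> t powr p" using v_pos[OF x0] by simp
  moreover have "t powr p < t powr 1" using t p by (intro powr_less_mono) auto
  ultimately show False using t by simp
qed

text \<open>The roles are exchanged: the maximum \<open>t\<close> of \<open>v / u\<close> over the
  closed ball exceeds 1, \<open>v / t\<close> touches \<open>u\<close> from below, and the equation
  gives \<open>1 \<le> t powr p / t\<close>. With the closed ball inside \<open>\<Omega>\<close>,
  \<open>u\<close> is positive where the quotient is formed.\<close>

lemma barrier_le_dirichlet_solution:
  fixes z :: "real^'n"
  assumes u: "dirichlet_solution k p \<Omega> u" and \<Omega>: "cball z r \<subseteq> \<Omega>" and r: "0 < r"
    and k: "0 < k" "k < CARD('n)" and p: "1/2 < p" "p < 1" and y: "y \<in> \<Omega>"
  shows "barrier ((1 - p) / (2 * k)) (1 / (1 - p)) r z y \<le> u y"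
proof (rule ccontr)
  define v where "v = barrier ((1 - p) / (2 * k)) (1 / (1 - p)) r z"
  assume "\<not> ?thesis"
  then have less: "u y < v y" by (simp add: v_def)
  have u_pos: "0 < u x" if "x \<in> \<Omega>" for x
    using that u by (auto simp: dirichlet_solution_def)
  have v_0: "v x = 0" if "x \<notin> cball z r" for x
    using that r k p by (auto simp: v_def intro!: barrier_eq_0)
  have y': "y \<in> cball z r" using v_0 less u_pos[OF y] by force
  have cont: "continuous_on (cball z r) (\<lambda>x. v x / u x)"
  proof (intro continuous_intros ballI)
    show "continuous_on (cball z r) u"
      using u \<Omega> closure_subset[of \<Omega>] continuous_on_subset[of "closure \<Omega>" u "cball z r"]
      by (simp add: dirichlet_solution_def)
    show "continuous_on (cball z r) v"
      using p unfolding v_def by (intro continuous_intros) auto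
  qed (use u_pos \<Omega> in force)
  obtain x0 where x0: "x0 \<in> cball z r" and max: "\<And>x. x \<in> cball z r \<Longrightarrow> v x / u x \<le> v x0 / u x0"
    using continuous_attains_sup[OF compact_cball _ cont] y' by (metis empty_iff)
  define t where "t = v x0 / u x0"
  have x0': "x0 \<in> \<Omega>" and u0: "0 < u x0" using x0 \<Omega> u_pos by auto
  have t: "1 < t"
    using less_le_trans[OF _ max[OF y'], of 1] less u_pos[OF y] by (simp add: t_def)
  have v_x0: "v x0 = t * u x0" using u0 by (simp add: t_def)
  \<comment> \<open>The maximum over the ball controls all of \<open>\<Omega>\<close>, because
    outside the ball \<open>v\<close> is 0 while \<open>u\<close> is positive.\<close>
  have "local_min_at \<Omega> (\<lambda>x. u x - (1 / t) * v x) x0"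
    unfolding local_min_at_def eventually_at_filter
  proof (intro always_eventually allI impI)
    fix x assume x: "x \<in> \<Omega>"
    have "v x \<le> t * u x"
    proof (cases "x \<in> cball z r")
      case True
      from max[OF this] show ?thesis using u_pos[OF x] by (simp add: t_def[symmetric] divide_le_eq)
    next
      case False
      then show ?thesis using v_0 t u_pos[OF x] by simp
    qed
    then show "u x0 - 1 / t * v x0 \<le> u x - 1 / t * v x"
      using t by (simp add: v_x0 divide_le_eq mult.commute)
  qed
  then have "u x0 powr p \<le> (1 / t) * v x0 powr p"
    using viscosity_solution_touching_barrier(2)[of k p \<Omega> u "1 / t" x0 r z] u k p t x0'
    by (simp add: dirichlet_solution_def v_def)
  also have "\<dots> = (t powr p / t) * u x0 powr p"
    using v_x0 t u0 by (simp add: powr_mult)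
  finally have "1 * u x0 powr p \<le> (t powr p / t) * u x0 powr p" by simp
  then have "1 \<le> t powr p / t" by (rule mult_right_le_imp_le) (use u0 in simp)
  moreover have "t powr p < t powr 1" using t p by (intro powr_less_mono) auto
  ultimately show False using t by simp
qed

section \<open>Gaussian bounds for barriers\<close>

lemma barrier_le_exp:
  assumes "0 < k" and "p < 1" and "(1 - p) / (2 * k) * r\<^sup>2 = 1 + (1 - p) * a"
  shows "barrier ((1 - p) / (2 * k)) (1 / (1 - p)) r z x \<le> exp (a - (norm (x - z))\<^sup>2 / (2 * k))"
proof -
  define s where "s = (1 - p) / (2 * k) * (r\<^sup>2 - (norm (x - z))\<^sup>2)"
  \<comment> \<open>The exponent \<open>1 / (1 - p)\<close> cancels the factor \<open>1 - p\<close>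
    here, so \<open>ln s \<le> s - 1\<close> gives a bound without further error in
    \<open>p\<close>.\<close>
  have s: "s - 1 = (1 - p) * (a - (norm (x - z))\<^sup>2 / (2 * k))"
    using assms(3) by (simp add: s_def algebra_simps)
  have "max 0 s powr (1 / (1 - p)) \<le> exp ((s - 1) / (1 - p))"
  proof (cases "s \<le> 0")
    case False
    then have "ln s \<le> s - 1" by (intro ln_le_minus_one) auto
    with False show ?thesis using assms(2) by (simp add: powr_def divide_right_mono)
  qed simp
  then show ?thesis using assms(2) unfolding barrier_def s_def[symmetric] by (simp add: s)
qed

text \<open>From below, \<open>ln (1 - e)\<close> is at least \<open>- e - 2 * e\<^sup>2\<close> for
  \<open>e\<close> between 0 and 1/2. After division by \<open>1 - p\<close> the quadratic term
  becomes \<open>2 * (1 - p) * w\<^sup>2\<close>, which is small for bounded \<open>w\<close> and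
  \<open>p\<close> near 1.\<close>

lemma exp_le_barrier:
  fixes x z :: "real^'n"
  assumes "0 < k" and "p < 1" and "(1 - p) / (2 * k) * r\<^sup>2 = 1 - (1 - p) * b" and "0 \<le> b"
  defines "w \<equiv> b + (norm (x - z))\<^sup>2 / (2 * k)"
  assumes "(1 - p) * w \<le> 1 / 2"
  shows "exp (- w - 2 * (1 - p) * w\<^sup>2) \<le> barrier ((1 - p) / (2 * k)) (1 / (1 - p)) r z x"
proof -
  define e where "e = (1 - p) * w"
  have s: "(1 - p) / (2 * k) * (r\<^sup>2 - (norm (x - z))\<^sup>2) = 1 - e"
    using assms(3) by (simp add: e_def w_def algebra_simps)
  have e: "0 \<le> e" "e \<le> 1 / 2"
    using assms by (auto simp: e_def w_def)
  have "- e - 2 * e\<^sup>2 \<le> ln (1 - e)"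
    using e by (rule ln_one_minus_pos_lower_bound)
  then have "(- e - 2 * e\<^sup>2) / (1 - p) \<le> ln (1 - e) / (1 - p)"
    using assms(2) by (intro divide_right_mono) auto
  moreover have "(- e - 2 * e\<^sup>2) / (1 - p) = - w - 2 * (1 - p) * w\<^sup>2"
    using assms(2) by (simp add: e_def field_simps power2_eq_square)
  ultimately show ?thesis
    using e unfolding barrier_def s by (simp add: powr_def)
qed

text \<open>Factoring out \<open>exp y\<close>, at most 1, leaves the deviation of
  \<open>exp (x - y)\<close> from 1. This turns bounds on logarithms into bounds on values.\<close>

lemma abs_diff_exp_le:
  fixes x y \<tau> :: real
  assumes "\<bar>x - y\<bar> \<le> \<tau>" and "y \<le> 0"
  shows "\<bar>exp x - exp y\<bar> \<le> exp \<tau> - 1"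
proof -
  have "1 - exp (- \<tau>) \<le> exp \<tau> - 1"
    using exp_ge_add_one_self[of \<tau>] exp_ge_add_one_self[of "- \<tau>"] by linarith
  moreover have "exp (- \<tau>) \<le> exp (x - y)" "exp (x - y) \<le> exp \<tau>"
    using assms(1) by auto
  ultimately have "\<bar>exp (x - y) - 1\<bar> \<le> exp \<tau> - 1" by linarith
  then have "exp y * \<bar>exp (x - y) - 1\<bar> \<le> 1 * (exp \<tau> - 1)"
    using assms(2) by (intro mult_mono) auto
  moreover have "exp x - exp y = exp y * (exp (x - y) - 1)"
    by (simp add: algebra_simps mult_exp_exp)
  ultimately show ?thesis by (simp add: abs_mult)
qed

lemma abs_norm_diff_square_le:
  assumes "norm (y - x) \<le> d" and "norm x \<le> L"
  shows "\<bar>(norm y)\<^sup>2 - (norm x)\<^sup>2\<bar> \<le> d * (2 * L + d)"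
proof -
  have "\<bar>norm y - norm x\<bar> \<le> d" using assms(1) norm_triangle_ineq3[of y x] by linarith
  then have "\<bar>norm y - norm x\<bar> * (norm y + norm x) \<le> d * (2 * L + d)"
    using assms(2) by (intro mult_mono) auto
  moreover have "(norm y)\<^sup>2 - (norm x)\<^sup>2 = (norm y - norm x) * (norm y + norm x)"
    by (simp add: power2_eq_square algebra_simps)
  ultimately show ?thesis by (simp add: abs_mult)
qed

section \<open>Quantitative estimates for a single exponent\<close>

text \<open>The exact radius \<open>sqrt (2 k / (1 - p))\<close> corresponds to \<open>a = b = 0\<close>; the defects \<open>a\<close> and \<open>b\<close> are
  normalised so that they perturb the logarithm of a barrier by \<open>O(a + b)\<close>, uniformly in \<open>p\<close>.\<close>

locale nearly_ball_solution =
  fixes k :: nat and p :: real and \<Omega> :: "(real^'n) set" and u :: "real^'n \<Rightarrow> real"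
    and z1 z2 :: "real^'n" and r1 r2 a b :: real
  assumes k: "0 < k" "k < CARD('n)" and p: "1/2 < p" "p < 1"
    and bounded: "bounded \<Omega>" and sol: "dirichlet_solution k p \<Omega> u"
    and inner: "cball z1 r1 \<subseteq> \<Omega>" "0 < r1" "(1 - p) / (2 * k) * r1\<^sup>2 = 1 - (1 - p) * b" "0 \<le> b"
    and outer: "closure \<Omega> \<subseteq> ball z2 r2" "(1 - p) / (2 * k) * r2\<^sup>2 = 1 + (1 - p) * a" "0 \<le> a"
begin

abbreviation "M \<equiv> max_value \<Omega> u"

lemma upper: "y \<in> closure \<Omega> \<Longrightarrow> u y \<le> exp (a - (norm (y - z2))\<^sup>2 / (2 * k))"
  using dirichlet_solution_le_barrier[OF sol bounded outer(1) k p]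
    barrier_le_exp[of "real k" p r2 a z2 y] k p outer(2) by force

text \<open>The majorant \<open>w\<close> lets one error term serve many points at once. Smallness
  of \<open>(1 - p) * w\<close> also forces \<open>y\<close> into the inscribed ball, hence into
  \<open>\<Omega>\<close>.\<close>

lemma lower:
  assumes "b + (norm (y - z1))\<^sup>2 / (2 * k) \<le> w" and "(1 - p) * w \<le> 1/2"
  shows "y \<in> \<Omega>" and "exp (- b - (norm (y - z1))\<^sup>2 / (2 * k) - 2 * (1 - p) * w\<^sup>2) \<le> u y"
proof -
  define v where "v = b + (norm (y - z1))\<^sup>2 / (2 * k)"
  have v: "0 \<le> v" "v \<le> w" using assms inner by (auto simp: v_def)
  have v': "(1 - p) * v \<le> 1/2"
    using mult_left_mono[OF v(2), of "1 - p"] assms(2) p by linarith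
  have "(1 - p) / (2 * k) * (norm (y - z1))\<^sup>2 = (1 - p) * v - (1 - p) * b"
    by (simp add: v_def algebra_simps)
  also have "\<dots> \<le> (1 - p) / (2 * k) * r1\<^sup>2" using v' inner(3) by linarith
  finally have "(norm (y - z1))\<^sup>2 \<le> r1\<^sup>2"
    by (rule mult_left_le_imp_le) (use k p in simp)
  then have "norm (y - z1) \<le> r1" by (rule power2_le_imp_le) (use inner(2) in simp)
  then show y: "y \<in> \<Omega>"
    using inner(1) by (auto simp: dist_norm norm_minus_commute)
  have "v\<^sup>2 \<le> w\<^sup>2" using v by (intro power_mono) auto
  then have "2 * (1 - p) * v\<^sup>2 \<le> 2 * (1 - p) * w\<^sup>2" using p by (intro mult_left_mono) auto
  then have "exp (- b - (norm (y - z1))\<^sup>2 / (2 * k) - 2 * (1 - p) * w\<^sup>2) \<le>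
      exp (- v - 2 * (1 - p) * v\<^sup>2)" by (simp add: v_def)
  also have "\<dots> \<le> barrier ((1 - p) / (2 * k)) (1 / (1 - p)) r1 z1 y"
    using exp_le_barrier[of "real k" p r1 b y z1] k p inner v' by (simp add: v_def)
  also have "\<dots> \<le> u y"
    by (rule barrier_le_dirichlet_solution[OF sol inner(1,2) k p y])
  finally show "exp (- b - (norm (y - z1))\<^sup>2 / (2 * k) - 2 * (1 - p) * w\<^sup>2) \<le> u y" .
qed

lemma u_le_exp_a:
  assumes "y \<in> closure \<Omega>"
  shows "u y \<le> exp a"
proof -
  have "exp (a - (norm (y - z2))\<^sup>2 / (2 * k)) \<le> exp a" by simp
  with upper[OF assms] show ?thesis by linarith
qed

text \<open>The upper barrier is at most \<open>exp a\<close> everywhere; the lower one is evaluated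
  at its centre \<open>z1\<close>, where the quadratic term vanishes.\<close>

lemma max_value_bounds:
  assumes "b \<le> w" and "(1 - p) * w \<le> 1/2"
  shows "0 < M" and "\<bar>ln M\<bar> \<le> a + b + 2 * (1 - p) * w\<^sup>2"
proof -
  have ne: "z1 \<in> \<Omega>" using inner by auto
  then have cl: "z1 \<in> closure \<Omega>" using closure_subset by blast
  have le: "M \<le> exp a"
    unfolding max_value_def using cl u_le_exp_a by (intro cSUP_least) auto
  have "exp (- b - 2 * (1 - p) * w\<^sup>2) \<le> u z1"
    using lower(2)[of z1 w] assms by simp
  also have "u z1 \<le> M"
    unfolding max_value_def using cl u_le_exp_a by (intro cSUP_upper bdd_aboveI2)
  finally have ge: "exp (- b - 2 * (1 - p) * w\<^sup>2) \<le> M" .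
  then show pos: "0 < M" using exp_gt_zero less_le_trans by blast
  have "ln M \<le> a" using le pos by (metis ln_exp ln_mono)
  moreover have "- b - 2 * (1 - p) * w\<^sup>2 \<le> ln M" using ge pos by (simp add: ln_ge_iff)
  moreover have "0 \<le> 2 * (1 - p) * w\<^sup>2" using p by simp
  ultimately show "\<bar>ln M\<bar> \<le> a + b + 2 * (1 - p) * w\<^sup>2"
    using inner outer by linarith
qed

text \<open>\<open>d\<close> bounds the distance from \<open>x\<close> to the dilated point,
  recentred at \<open>z1\<close> or at \<open>z2\<close>, so the squared norms change by at most
  \<open>d * (2 * L + d)\<close>.\<close>

lemma rescaled_close_to_gaussian:
  fixes L d w :: real
  assumes x: "norm x \<le> L" and d: "\<bar>M powr ((1 - p) / 2) - 1\<bar> * L + norm z1 + norm z2 \<le> d"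
    and w: "b + (L\<^sup>2 + d * (2 * L + d)) / (2 * k) \<le> w" "(1 - p) * w \<le> 1 / 2"
  shows "x \<in> rescaled_domain p \<Omega> u"
    and "\<bar>rescaled p \<Omega> u x - exp (- (norm x)\<^sup>2 / (2 * k))\<bar> \<le>
      exp (2 * a + 2 * b + 4 * (1 - p) * w\<^sup>2 + d * (2 * L + d) / (2 * k)) - 1"
proof -
  define y where "y = (M powr ((1 - p) / 2)) *\<^sub>R x"
  define E where "E = d * (2 * L + d)"
  have L: "0 \<le> L" using x norm_ge_zero order_trans by blast
  then have d0: "0 \<le> d" using d by (smt (verit) mult_nonneg_nonneg norm_ge_zero)
  have E0: "0 \<le> E" using L d0 by (simp add: E_def)
  have bw: "b \<le> w" using w(1) E0 by (smt (verit) E_def divide_nonneg_nonneg of_nat_0_le_iff zero_le_power2)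
  note M = max_value_bounds[OF bw w(2)]
  have yx: "norm (y - x) \<le> \<bar>M powr ((1 - p) / 2) - 1\<bar> * L"
  proof -
    have "y - x = (M powr ((1 - p) / 2) - 1) *\<^sub>R x" by (simp add: y_def algebra_simps)
    then show ?thesis using x by (simp add: mult_left_mono)
  qed
  have close: "\<bar>(norm (y - z))\<^sup>2 / (2 * k) - (norm x)\<^sup>2 / (2 * k)\<bar> \<le> E / (2 * k)"
    if "norm z \<le> norm z1 + norm z2" for z
  proof -
    have "norm (y - z - x) \<le> norm (y - x) + norm z"
      using norm_triangle_ineq4[of "y - x" z] by (simp add: algebra_simps)
    then have "norm (y - z - x) \<le> d" using yx d that by linarith
    from abs_norm_diff_square_le[OF this x] show ?thesis
      using k by (simp add: E_def diff_divide_distrib[symmetric] divide_right_mono)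
  qed
  note close1 = close[of z1, simplified] and close2 = close[of z2, simplified]
  have "b + (norm (y - z1))\<^sup>2 / (2 * k) \<le> w"
  proof -
    have "(norm x)\<^sup>2 / (2 * k) \<le> L\<^sup>2 / (2 * k)" using x by (intro divide_right_mono power_mono) auto
    then show ?thesis using close1 w(1) by (simp add: E_def add_divide_distrib)
  qed
  note low = lower[OF this w(2)]
  have "M powr ((p - 1) / 2) * M powr ((1 - p) / 2) = 1"
    using M(1) by (simp add: powr_add[symmetric] add_divide_distrib[symmetric])
  then have "x = M powr ((p - 1) / 2) *\<^sub>R y" by (simp add: y_def)
  then show "x \<in> rescaled_domain p \<Omega> u"
    using low(1) unfolding rescaled_domain_def by blast
  have u0: "0 < u y" using low(2) exp_gt_zero less_le_trans by blast
  have "u y \<le> exp (a - (norm (y - z2))\<^sup>2 / (2 * k))"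
    using upper low(1) closure_subset by blast
  then have "ln (u y) \<le> a - (norm (y - z2))\<^sup>2 / (2 * k)"
    using u0 by (metis ln_exp ln_mono)
  moreover have "- b - (norm (y - z1))\<^sup>2 / (2 * k) - 2 * (1 - p) * w\<^sup>2 \<le> ln (u y)"
    using low(2) u0 by (simp add: ln_ge_iff)
  moreover have "0 \<le> 2 * (1 - p) * w\<^sup>2" using p by simp
  moreover have "4 * (1 - p) * w\<^sup>2 = 2 * (2 * (1 - p) * w\<^sup>2)" by simp
  moreover have "- (norm x)\<^sup>2 / (2 * k) = - ((norm x)\<^sup>2 / (2 * k))" by simp
  \<comment> \<open>One copy of \<open>a + b + 2 * (1 - p) * w\<^sup>2\<close> pays for
    \<open>ln M\<close>, the other for \<open>ln (u y)\<close>.\<close>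
  ultimately have "\<bar>(ln (u y) - ln M) - (- (norm x)\<^sup>2 / (2 * k))\<bar> \<le>
      2 * a + 2 * b + 4 * (1 - p) * w\<^sup>2 + E / (2 * k)"
    using M(2) close1 close2 inner(4) outer(3) by linarith
  then have "\<bar>exp (ln (u y) - ln M) - exp (- (norm x)\<^sup>2 / (2 * k))\<bar> \<le>
      exp (2 * a + 2 * b + 4 * (1 - p) * w\<^sup>2 + E / (2 * k)) - 1"
    by (rule abs_diff_exp_le) simp
  then show "\<bar>rescaled p \<Omega> u x - exp (- (norm x)\<^sup>2 / (2 * k))\<bar> \<le>
      exp (2 * a + 2 * b + 4 * (1 - p) * w\<^sup>2 + d * (2 * L + d) / (2 * k)) - 1"
    using u0 M(1) by (simp add: rescaled_def y_def[symmetric] exp_diff E_def)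
qed

end

section \<open>Passage to the limit\<close>

lemma perturbed_radius_square:
  fixes \<sigma> h y :: real
  assumes "\<sigma> \<noteq> 0"
  shows "(\<sigma> + 2 * h * y)\<^sup>2 / \<sigma>\<^sup>2 = 1 + h * (2 * y * (\<sigma> + h * y) / (\<sigma>\<^sup>2 / 2))"
  using assms by (simp add: field_simps power2_eq_square)

theorem proposition3p5:
  fixes k :: nat
    and \<Omega> :: "real \<Rightarrow> (real^'n) set"
    and R :: "real \<Rightarrow> real"
    and Y :: "real \<Rightarrow> (real^'n) set"
    and U :: "real \<Rightarrow> real^'n \<Rightarrow> real"
    and xbar xhat :: "real \<Rightarrow> real^'n"
    and \<rho>bar \<rho>hat :: "real \<Rightarrow> real"
  assumes "CARD('n) \<ge> 2" and "k > 0" and "k < CARD('n)"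
    and "\<And>p. p \<in> {0<..<1} \<Longrightarrow>
           open (\<Omega> p) \<and> \<Omega> p \<noteq> {} \<and> bounded (\<Omega> p) \<and> convex (\<Omega> p)"
    and "\<And>p. p \<in> {0<..<1} \<Longrightarrow> R p > 0 \<and> \<Omega> p = (\<Inter>y\<in>Y p. ball y (R p))"
    and "\<And>p. p \<in> {0<..<1} \<Longrightarrow> dirichlet_solution k p (\<Omega> p) (U p)"
    and "\<And>p. p \<in> {0<..<1} \<Longrightarrow> \<rho>bar p > 0 \<and> \<rho>hat p > 0"
    and "\<And>p. p \<in> {0<..<1} \<Longrightarrow>
           ball (xbar p) (sqrt (2 * real k / (1 - p)) - \<rho>bar p) \<subseteq> \<Omega> p \<and>
           \<Omega> p \<subseteq> ball (xhat p) (sqrt (2 * real k / (1 - p)) + \<rho>hat p)"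
    and "((\<lambda>p. norm (xbar p) + norm (xhat p)) \<longlongrightarrow> 0) (at_left 1)"
    and "((\<lambda>p. (\<rho>bar p + \<rho>hat p) / sqrt (1 - p)) \<longlongrightarrow> 0) (at_left 1)"
  shows "\<forall>K. compact K \<longrightarrow>
           (\<forall>\<^sub>F p in at_left 1. K \<subseteq> rescaled_domain p (\<Omega> p) (U p)) \<and>
           uniform_limit K (\<lambda>p. rescaled p (\<Omega> p) (U p))
             (\<lambda>x. exp (- (norm x)\<^sup>2 / (2 * real k))) (at_left 1)"
proof (intro allI impI)
  fix K :: "(real^'n) set"
  assume "compact K"
  then obtain L where L: "0 < L" "\<And>x. x \<in> K \<Longrightarrow> norm x \<le> L"
    using compact_imp_bounded bounded_pos by metis
  have k: "0 < k" "k < CARD('n)" by fact+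
  define \<sigma> where "\<sigma> = sqrt (2 * real k)"
  have \<sigma>: "0 < \<sigma>" "\<sigma>\<^sup>2 = 2 * real k" using k by (simp_all add: \<sigma>_def)
  define y1 y2 where "y1 = (\<lambda>p. \<rho>bar p / sqrt (1 - p))" and "y2 = (\<lambda>p. \<rho>hat p / sqrt (1 - p))"
  \<comment> \<open>Multiplied by \<open>sqrt (1 - p)\<close>, the radii with doubled errors are
    \<open>\<sigma> - 2 * (1 - p) * y1 p\<close> and \<open>\<sigma> + 2 * (1 - p) * y2 p\<close>.
    Their squares over \<open>\<sigma>\<^sup>2\<close> are \<open>1 - (1 - p) * b p\<close> and
    \<open>1 + (1 - p) * a p\<close>.\<close>
  define a b where "a = (\<lambda>p. 2 * y2 p * (\<sigma> + (1 - p) * y2 p) / k)"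
    and "b = (\<lambda>p. 2 * y1 p * (\<sigma> - (1 - p) * y1 p) / k)"
  have p_lim: "((\<lambda>p::real. p) \<longlongrightarrow> 1) (at_left 1)" by (rule tendsto_ident_at)
  have ev_p: "\<forall>\<^sub>F p::real in at_left 1. p \<in> {1/2<..<1}"
    by (rule eventually_at_left_real) simp
  have ev_y: "\<forall>\<^sub>F p in at_left 1. norm (y1 p) \<le> (\<rho>bar p + \<rho>hat p) / sqrt (1 - p) \<and>
      norm (y2 p) \<le> (\<rho>bar p + \<rho>hat p) / sqrt (1 - p)"
    using ev_p
  proof eventually_elim
    fix p :: real assume p: "p \<in> {1/2<..<1}"
    then have "0 < \<rho>bar p" "0 < \<rho>hat p" using assms(7)[of p] by auto
    with p show "norm (y1 p) \<le> (\<rho>bar p + \<rho>hat p) / sqrt (1 - p) \<and>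
      norm (y2 p) \<le> (\<rho>bar p + \<rho>hat p) / sqrt (1 - p)"
      by (simp add: y1_def y2_def divide_right_mono)
  qed
  have y_lim: "(y1 \<longlongrightarrow> 0) (at_left 1)" "(y2 \<longlongrightarrow> 0) (at_left 1)"
    by (rule Lim_null_comparison[OF eventually_mono[OF ev_y] assms(10)]; simp)+
  have a_lim: "(a \<longlongrightarrow> 0) (at_left 1)" and b_lim: "(b \<longlongrightarrow> 0) (at_left 1)"
    using k unfolding a_def b_def by (auto intro!: tendsto_eq_intros p_lim y_lim)
  \<comment> \<open>This guarantees a positive inner radius \<open>r1 p\<close>.\<close>
  have "((\<lambda>p. 2 * (1 - p) * y1 p) \<longlongrightarrow> 0) (at_left 1)"
    by (auto intro!: tendsto_eq_intros p_lim y_lim)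
  then have ev_y1: "\<forall>\<^sub>F p in at_left 1. 2 * (1 - p) * y1 p < \<sigma>"
    using \<sigma>(1) by (rule order_tendstoD)
  define r1 r2 where "r1 = (\<lambda>p. sqrt (2 * real k / (1 - p)) - 2 * \<rho>bar p)"
    and "r2 = (\<lambda>p. sqrt (2 * real k / (1 - p)) + 2 * \<rho>hat p)"
  \<comment> \<open>Doubling the radius errors makes both inclusions strict.\<close>
  have ev_sol: "\<forall>\<^sub>F p in at_left 1.
      nearly_ball_solution k p (\<Omega> p) (U p) (xbar p) (xhat p) (r1 p) (r2 p) (a p) (b p)"
    using ev_p ev_y1
  proof eventually_elim
    fix p :: real
    assume p: "p \<in> {1/2<..<1}" and y1: "2 * (1 - p) * y1 p < \<sigma>"
    define s where "s = sqrt (1 - p)"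
    have s: "0 < s" "s\<^sup>2 = 1 - p" using p by (simp_all add: s_def)
    have p01: "p \<in> {0<..<1}" using p by simp
    have \<rho>: "0 < \<rho>bar p" "0 < \<rho>hat p" "\<rho>bar p = s * y1 p" "\<rho>hat p = s * y2 p"
      using assms(7)[OF p01] s by (auto simp: y1_def y2_def s_def[symmetric])
    have y_pos: "0 < y1 p" "0 < y2 p" using \<rho> s by (simp_all add: zero_less_mult_iff)
    have R: "sqrt (2 * real k / (1 - p)) = \<sigma> / s"
      by (simp add: \<sigma>_def s_def real_sqrt_divide)
    have sr: "s * r1 p = \<sigma> - 2 * (1 - p) * y1 p" "s * r2 p = \<sigma> + 2 * (1 - p) * y2 p"
      using s(1) unfolding r1_def r2_def R \<rho>(3,4) unfolding s(2)[symmetric]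
      by (simp_all add: algebra_simps power2_eq_square)
    have r_sq: "(1 - p) / (2 * k) * r\<^sup>2 = (s * r)\<^sup>2 / \<sigma>\<^sup>2" for r
      by (simp add: \<sigma>(2) s(2)[symmetric] power_mult_distrib)
    show "nearly_ball_solution k p (\<Omega> p) (U p) (xbar p) (xhat p) (r1 p) (r2 p) (a p) (b p)"
    proof
      show "0 < k" "k < CARD('n)" "1/2 < p" "p < 1" using k p by auto
      show "bounded (\<Omega> p)" "dirichlet_solution k p (\<Omega> p) (U p)"
        using assms(4,6)[OF p01] by auto
      have "cball (xbar p) (r1 p) \<subseteq> ball (xbar p) (sqrt (2 * real k / (1 - p)) - \<rho>bar p)"
        using \<rho>(1) by (auto simp: r1_def)
      then show "cball (xbar p) (r1 p) \<subseteq> \<Omega> p" using assms(8)[OF p01] by blast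
      have "closure (\<Omega> p) \<subseteq> cball (xhat p) (sqrt (2 * real k / (1 - p)) + \<rho>hat p)"
        using assms(8)[OF p01] ball_subset_cball by (intro closure_minimal) blast+
      then show "closure (\<Omega> p) \<subseteq> ball (xhat p) (r2 p)"
        using \<rho>(2) by (force simp: r2_def)
      show "0 < r1 p" using sr(1) y1 s(1) by (metis diff_gt_0_iff_gt zero_less_mult_pos)
      show "(1 - p) / (2 * k) * (r1 p)\<^sup>2 = 1 - (1 - p) * b p"
        using perturbed_radius_square[of \<sigma> "1 - p" "- y1 p"] \<sigma>(1)
        unfolding r_sq sr b_def \<sigma>(2) by simp
      show "(1 - p) / (2 * k) * (r2 p)\<^sup>2 = 1 + (1 - p) * a p"
        using perturbed_radius_square[of \<sigma> "1 - p" "y2 p"] \<sigma>(1)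
        unfolding r_sq sr a_def \<sigma>(2) by simp
      show "0 \<le> a p" using y_pos \<sigma>(1) p by (simp add: a_def)
      have "0 \<le> (1 - p) * y1 p" using y_pos p by simp
      then have "0 \<le> \<sigma> - (1 - p) * y1 p" using y1 by linarith
      then show "0 \<le> b p" using y_pos by (simp add: b_def)
    qed
  qed
  define M where "M = (\<lambda>p. max_value (\<Omega> p) (U p))"
  \<comment> \<open>At the centre of the inner ball \<open>b p\<close> itself serves as the
    majorant, so a first bound on \<open>M p\<close> is available before \<open>w\<close> is
    chosen.\<close>
  have "((\<lambda>p. (1 - p) * b p) \<longlongrightarrow> 0) (at_left 1)"
    by (auto intro!: tendsto_eq_intros p_lim b_lim)
  then have "\<forall>\<^sub>F p in at_left 1. (1 - p) * b p < 1/2"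
    by (rule order_tendstoD) simp
  with ev_sol have ev_M: "\<forall>\<^sub>F p in at_left 1. 0 < M p \<and> \<bar>ln (M p)\<bar> \<le> a p + b p + 2 * (1 - p) * (b p)\<^sup>2"
  proof eventually_elim
    fix p :: real
    assume sol: "nearly_ball_solution k p (\<Omega> p) (U p) (xbar p) (xhat p) (r1 p) (r2 p) (a p) (b p)"
      and "(1 - p) * b p < 1/2"
    then show "0 < M p \<and> \<bar>ln (M p)\<bar> \<le> a p + b p + 2 * (1 - p) * (b p)\<^sup>2"
      using nearly_ball_solution.max_value_bounds[OF sol order_refl] by (simp add: M_def)
  qed
  have "((\<lambda>p. a p + b p + 2 * (1 - p) * (b p)\<^sup>2) \<longlongrightarrow> 0) (at_left 1)"
    by (auto intro!: tendsto_eq_intros p_lim a_lim b_lim)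
  then have lnM_lim: "((\<lambda>p. ln (M p)) \<longlongrightarrow> 0) (at_left 1)"
    by (rule Lim_null_comparison[rotated]) (use ev_M in \<open>auto elim: eventually_mono\<close>)
  \<comment> \<open>The dilation factor of the rescaling tends to 1.\<close>
  have "((\<lambda>p. exp ((1 - p) / 2 * ln (M p))) \<longlongrightarrow> 1) (at_left 1)"
    using tendsto_exp[OF tendsto_mult[OF tendsto_divide[OF tendsto_diff[OF tendsto_const[of 1] p_lim]
      tendsto_const[of 2]] lnM_lim]]
    by simp
  then have M_lim: "((\<lambda>p. M p powr ((1 - p) / 2)) \<longlongrightarrow> 1) (at_left 1)"
    by (rule Lim_transform_eventually)
      (use ev_M in \<open>auto elim!: eventually_mono simp: powr_def\<close>)
  define d where "d = (\<lambda>p. \<bar>M p powr ((1 - p) / 2) - 1\<bar> * L + (norm (xbar p) + norm (xhat p)))"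
  have d_lim: "(d \<longlongrightarrow> 0) (at_left 1)"
    unfolding d_def
    using tendsto_add[OF tendsto_mult_right[OF tendsto_rabs[OF tendsto_diff[OF M_lim
      tendsto_const[of 1]]], of L] assms(9)]
    by simp
  define w where "w = (\<lambda>p. b p + (L\<^sup>2 + d p * (2 * L + d p)) / (2 * k))"
  have w_lim: "(w \<longlongrightarrow> L\<^sup>2 / (2 * k)) (at_left 1)"
    using k unfolding w_def by (auto intro!: tendsto_eq_intros b_lim d_lim)
  have "((\<lambda>p. (1 - p) * w p) \<longlongrightarrow> 0) (at_left 1)"
    by (auto intro!: tendsto_eq_intros p_lim w_lim)
  then have ev_w: "\<forall>\<^sub>F p in at_left 1. (1 - p) * w p < 1/2"
    by (rule order_tendstoD) simp
  \<comment> \<open>The total logarithmic error depends on \<open>K\<close> only through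
    \<open>L\<close>, which makes the convergence uniform on \<open>K\<close>.\<close>
  define \<tau> where "\<tau> = (\<lambda>p. 2 * a p + 2 * b p + 4 * (1 - p) * (w p)\<^sup>2 + d p * (2 * L + d p) / (2 * k))"
  have \<tau>_lim: "((\<lambda>p. exp (\<tau> p) - 1) \<longlongrightarrow> 0) (at_left 1)"
    using k unfolding \<tau>_def by (auto intro!: tendsto_eq_intros p_lim a_lim b_lim d_lim w_lim)
  have main: "\<forall>\<^sub>F p in at_left 1. \<forall>x\<in>K. x \<in> rescaled_domain p (\<Omega> p) (U p) \<and>
      \<bar>rescaled p (\<Omega> p) (U p) x - exp (- (norm x)\<^sup>2 / (2 * k))\<bar> \<le> exp (\<tau> p) - 1"
    using ev_sol ev_w
  proof eventually_elim
    fix p :: real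
    assume "nearly_ball_solution k p (\<Omega> p) (U p) (xbar p) (xhat p) (r1 p) (r2 p) (a p) (b p)"
      and w: "(1 - p) * w p < 1/2"
    then interpret nearly_ball_solution k p "\<Omega> p" "U p" "xbar p" "xhat p" "r1 p" "r2 p" "a p" "b p"
      by simp
    show "\<forall>x\<in>K. x \<in> rescaled_domain p (\<Omega> p) (U p) \<and>
      \<bar>rescaled p (\<Omega> p) (U p) x - exp (- (norm x)\<^sup>2 / (2 * k))\<bar> \<le> exp (\<tau> p) - 1"
      using rescaled_close_to_gaussian[OF L(2), of _ "d p" "w p"] w
      by (simp add: \<tau>_def d_def M_def w_def)
  qed
  show "(\<forall>\<^sub>F p in at_left 1. K \<subseteq> rescaled_domain p (\<Omega> p) (U p)) \<and>
           uniform_limit K (\<lambda>p. rescaled p (\<Omega> p) (U p))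
             (\<lambda>x. exp (- (norm x)\<^sup>2 / (2 * real k))) (at_left 1)"
  proof
    show "\<forall>\<^sub>F p in at_left 1. K \<subseteq> rescaled_domain p (\<Omega> p) (U p)"
      using main by eventually_elim blast
    show "uniform_limit K (\<lambda>p. rescaled p (\<Omega> p) (U p))
        (\<lambda>x. exp (- (norm x)\<^sup>2 / (2 * real k))) (at_left 1)"
    proof (rule uniform_limitI)
      fix e :: real assume "0 < e"
      with \<tau>_lim have "\<forall>\<^sub>F p in at_left 1. exp (\<tau> p) - 1 < e" by (rule order_tendstoD)
      with main show "\<forall>\<^sub>F p in at_left 1. \<forall>x\<in>K.
          dist (rescaled p (\<Omega> p) (U p) x) (exp (- (norm x)\<^sup>2 / (2 * real k))) < e"
        by eventually_elim (force simp: dist_real_def)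
    qed
  qed
qed

end
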